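(* Let $m\ge 1$ and let $\{A^{[t]}=(a_{ij}^{[t]})_{i,j=1}^m,\ t\ge 0\}$ be a family of invertible real $m\times m$ matrices with inverses $(A^{[t]})^{-1}=(b_{ij}^{[t]})$. Put $\mathcal T=\{(s,t): 0\le s\le t\}$. (1) Let $\beta_{ijk}^{(s)}$, $i,j,k=1,\dots,m$, be real functions of $s\ge0$ with $\sum_{j=1}^m\beta_{ijk}^{(s)}=a_{ik}^{[s]}$ for all $i,k,s$, and for $(s,t)\in\mathcal T$ let $\mathcal A^{[s,t]}$ be the $m$-dimensional real algebra with structural constants $c_{ijr}^{[s,t]}=\sum_{k=1}^m\beta_{ijk}^{(s)}b_{kr}^{[t]}$. Then the set of $(s,t)\in\mathcal T$ for which $\mathcal A^{[s,t]}$ is associative is \[\Big\{(s,t)\in \mathcal T: \sum_{p,r=1}^m\left(\beta_{ijp}^{(s)}\beta_{rkq}^{(s)}-\beta_{irq}^{(s)}\beta_{jkp}^{(s)}\right)b^{[t]}_{pr}=0 \ \text{ for all } i,j,k,q\Big\}.\] (2) Let $\gamma_{ijk}^{(t)}$, $i,j,k=1,\dots,m$, be real functions of $t\ge0$ with $\sum_{j=1}^m\gamma_{ijk}^{(t)}=b_{ik}^{[t]}$ for all $i,k,t$, and for $(s,t)\in\mathcal T$ let $\mathcal A^{[s,t]}$ be the $m$-dimensional real algebra with structural constants $c_{ijr}^{[s,t]}=\sum_{k=1}^m a_{ik}^{[s]}\gamma_{kjr}^{(t)}$. Then the set of $(s,t)\in\mathcal T$ for which $\mathcal A^{[s,t]}$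 is associative is \[\Big\{(s,t)\in \mathcal T: \sum_{r,q=1}^m\Big(a_{rq}^{[s]}\gamma_{pjr}^{(t)}\gamma_{qkl}^{(t)}-a_{jq}^{[s]}\gamma_{prl}^{(t)}\gamma_{qkr}^{(t)}\Big)=0 \ \text{ for all } p,j,k,l\Big\}.\]
   Context: The $m$-dimensional real algebra with structural constants $(c_{ijk})_{i,j,k=1}^m$ is the real vector space with basis $e_1,\dots,e_m$ and bilinear multiplication determined by $e_ie_j=\sum_{k=1}^m c_{ijk}e_k$. *)

theory Defs
  imports "HOL-Analysis.Analysis"
begin

text \<open>The algebra with structural constants \<open>c\<close> is modelled on the coordinate space
  \<open>real ^ 'm\<close>, with \<open>axis i 1\<close> in the role of the basis vector \<open>e\<^sub>i\<close>; its dimension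
  \<open>CARD('m)\<close> is an arbitrary positive number.\<close>

definition alg_mult :: "('m::finite \<Rightarrow> 'm \<Rightarrow> 'm \<Rightarrow> real) \<Rightarrow> real ^ 'm \<Rightarrow> real ^ 'm \<Rightarrow> real ^ 'm" where
  "alg_mult c x y =
     (\<Sum>i\<in>UNIV. \<Sum>j\<in>UNIV. (x $ i * y $ j) *\<^sub>R (\<Sum>k\<in>UNIV. c i j k *\<^sub>R axis k 1))"

definition alg_associative :: "('m::finite \<Rightarrow> 'm \<Rightarrow> 'm \<Rightarrow> real) \<Rightarrow> bool" where
  "alg_associative c \<longleftrightarrow>
     (\<forall>x y z. alg_mult c (alg_mult c x y) z = alg_mult c x (alg_mult c y z))"

definition time_pairs :: "(real \<times> real) set" where
  "time_pairs = {(s, t). 0 \<le> s \<and> s \<le> t}"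

lemma bilinear_alg_mult: "bilinear (alg_mult c)"
  unfolding bilinear_def alg_mult_def
  by (auto intro!: linearI
      simp: algebra_simps scaleR_add_left sum.distrib scaleR_sum_right)

lemma alg_mult_axis:
  "alg_mult c (axis i 1) (axis j 1) = (\<Sum>k\<in>UNIV. c i j k *\<^sub>R axis k 1)"
proof -
  have "alg_mult c (axis i 1) (axis j 1) =
    (\<Sum>i'\<in>UNIV. \<Sum>j'\<in>UNIV. if j' = j then if i' = i
       then \<Sum>k\<in>UNIV. c i' j' k *\<^sub>R axis k 1 else 0 else 0)"
    unfolding alg_mult_def
  proof (intro sum.cong refl)
    fix i' j' :: 'a
    show "(axis i 1 $ i' * axis j 1 $ j') *\<^sub>R (\<Sum>k\<in>UNIV. c i' j' k *\<^sub>R axis k 1) =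
      (if j' = j then if i' = i then \<Sum>k\<in>UNIV. c i' j' k *\<^sub>R axis k 1 else 0 else 0)"
      by (cases "i' = i"; cases "j' = j") (simp_all add: axis_def[of i] axis_def[of j])
  qed
  then show ?thesis by simp
qed

lemma alg_mult_unique:
  assumes "bilinear f"
    and "\<And>i j. f (axis i 1) (axis j 1) = (\<Sum>k\<in>UNIV. c i j k *\<^sub>R axis k 1)"
  shows "f = alg_mult c"
proof (intro ext)
  fix x y :: "real ^ 'a"
  have "f u v = alg_mult c u v" if "u \<in> Basis" "v \<in> Basis" for u v
    using that by (auto simp: Basis_vec_def assms(2) alg_mult_axis)
  then show "f x y = alg_mult c x y"
    using bilinear_eq[OF assms(1) bilinear_alg_mult, of UNIV Basis UNIV Basis x y] by simp
qed

end

theory Submission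
  imports Defs
begin

text \<open>
  An algebra is associative iff its associator vanishes on all triples of basis vectors, that is,
  iff \<open>\<Sum>\<^sub>r c\<^sub>i\<^sub>j\<^sub>r c\<^sub>r\<^sub>k\<^sub>l = \<Sum>\<^sub>r c\<^sub>j\<^sub>k\<^sub>r c\<^sub>i\<^sub>r\<^sub>l\<close> for all \<open>i, j, k, l\<close> (\<open>alg_associative_iff\<close>).
  When each structural constant is a product of an arbitrary tensor with a fixed matrix, that
  matrix can be pulled out of the associator: one copy of it stays inside as the coupling between
  the two tensors, the other copy acts on a free index from outside.  For
  \<open>c\<^sub>i\<^sub>j\<^sub>r = \<Sum>\<^sub>k \<beta>\<^sub>i\<^sub>j\<^sub>k b\<^sub>k\<^sub>r\<close> the outer copy acts on the last index from the right, and for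
  \<open>c\<^sub>i\<^sub>j\<^sub>r = \<Sum>\<^sub>k a\<^sub>i\<^sub>k \<gamma>\<^sub>k\<^sub>j\<^sub>r\<close> it acts on the first index from the left.  An invertible
  matrix annihilates only the zero vector, so the outer copy can be cancelled, and what remains is
  the condition in the theorem.
\<close>

text \<open>Both sides of the associative law are trilinear, so it suffices to compare them on basis
  vectors; there the two sides are the two contractions of \<open>c\<close> with itself.\<close>

lemma alg_associative_iff:
  fixes c :: "'m::finite \<Rightarrow> 'm \<Rightarrow> 'm \<Rightarrow> real"
  shows "alg_associative c \<longleftrightarrow>
    (\<forall>i j k l. (\<Sum>r\<in>UNIV. c i j r * c r k l) = (\<Sum>r\<in>UNIV. c j k r * c i r l))"
proof -
  note linear_left = bilinear_alg_mult[of c, unfolded bilinear_def, THEN conjunct2, rule_format]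
    and linear_right = bilinear_alg_mult[of c, unfolded bilinear_def, THEN conjunct1, rule_format]
  have component: "alg_mult c (axis i 1) (axis j 1) $ k = c i j k" for i j k
    unfolding alg_mult_axis by (simp add: axis_def if_distrib[of "(*) _"] cong: if_cong)
  have left: "alg_mult c (alg_mult c (axis i 1) (axis j 1)) (axis k 1) $ l =
      (\<Sum>r\<in>UNIV. c i j r * c r k l)" for i j k l
    by (simp add: alg_mult_axis[of c i j] linear_sum[OF linear_left] linear_cmul[OF linear_left]
        component)
  have right: "alg_mult c (axis i 1) (alg_mult c (axis j 1) (axis k 1)) $ l =
      (\<Sum>r\<in>UNIV. c j k r * c i r l)" for i j k l
    by (simp add: alg_mult_axis[of c j k] linear_sum[OF linear_right] linear_cmul[OF linear_right]
        component)
  show ?thesis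
  proof
    assume "alg_associative c"
    then show "\<forall>i j k l. (\<Sum>r\<in>UNIV. c i j r * c r k l) = (\<Sum>r\<in>UNIV. c j k r * c i r l)"
      by (simp only: alg_associative_def left[symmetric] right[symmetric] simp_thms)
  next
    assume contractions:
      "\<forall>i j k l. (\<Sum>r\<in>UNIV. c i j r * c r k l) = (\<Sum>r\<in>UNIV. c j k r * c i r l)"
    have basis: "alg_mult c (alg_mult c u v) w = alg_mult c u (alg_mult c v w)"
      if in_basis: "u \<in> Basis" "v \<in> Basis" "w \<in> Basis" for u v w
    proof -
      obtain i j k where "u = axis i 1" "v = axis j 1" "w = axis k 1"
        using in_basis by (auto simp: Basis_vec_def)
      with contractions show ?thesis
        by (intro vec_eq_iff[THEN iffD2]) (simp add: left right)
    qed
    have bilin_left: "bilinear (\<lambda>x y. alg_mult c (alg_mult c x y) w)" for w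
      unfolding bilinear_def
      by (intro conjI allI linear_compose[OF linear_left linear_left, unfolded o_def]
          linear_compose[OF linear_right linear_left, unfolded o_def])
    have bilin_right: "bilinear (\<lambda>x y. alg_mult c x (alg_mult c y w))" for w
      unfolding bilinear_def
      by (intro conjI allI linear_left linear_compose[OF linear_left linear_right, unfolded o_def])
    have two: "alg_mult c (alg_mult c x y) w = alg_mult c x (alg_mult c y w)"
      if "w \<in> Basis" for x y w
      using bilinear_eq[OF bilin_left bilin_right, of UNIV Basis UNIV Basis x y w w] basis that
      by simp
    have "alg_mult c (alg_mult c x y) z = alg_mult c x (alg_mult c y z)" for x y z
      using linear_eq_on[OF linear_right[of "alg_mult c x y"]
          linear_compose[OF linear_right[of y] linear_right[of x], unfolded o_def], of z Basis] two
      by simp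
    then show "alg_associative c"
      by (simp add: alg_associative_def)
  qed
qed

lemma invertible_matrix_inv:
  fixes A :: "'a::semiring_1 ^ 'n ^ 'm"
  assumes "invertible A"
  shows "invertible (matrix_inv A)"
  using someI_ex[OF assms[unfolded invertible_def]] unfolding matrix_inv_def invertible_def by blast

lemma invertible_mult_eq_0_iff:
  fixes A :: "real ^ 'n ^ 'n"
  assumes "invertible A"
  shows "(\<forall>i. (\<Sum>p\<in>UNIV. A $ i $ p * d p) = 0) \<longleftrightarrow> (\<forall>p. d p = 0)"
proof -
  have "A *v (\<chi> p. d p) = 0 \<longleftrightarrow> (\<chi> p. d p) = 0"
    using inj_matrix_vector_mult[OF assms] matrix_vector_mult_0_right[of A]
    by (metis injD)
  then show ?thesis
    by (simp add: vec_eq_iff matrix_vector_mult_def)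
qed

lemma mult_invertible_eq_0_iff:
  fixes B :: "real ^ 'n ^ 'n"
  assumes "invertible B"
  shows "(\<forall>l. (\<Sum>q\<in>UNIV. d q * B $ q $ l) = 0) \<longleftrightarrow> (\<forall>q. d q = 0)"
  using invertible_mult_eq_0_iff[OF transpose_invertible[OF assms], of d]
  by (simp add: transpose_def mult.commute)

text \<open>In the associator of these constants the inner \<open>B\<close> couples \<open>p\<close> to \<open>r\<close>, and the outer
  \<open>B\<close> turns \<open>q\<close> into the output index \<open>l\<close>.\<close>

lemma alg_associative_mult_right_iff:
  fixes B :: "real ^ 'm ^ 'm"
  assumes "invertible B"
  shows "alg_associative (\<lambda>i j r. \<Sum>k\<in>UNIV. \<beta> i j k * B $ k $ r) \<longleftrightarrow>
    (\<forall>i j k q. (\<Sum>p\<in>UNIV. \<Sum>r\<in>UNIV.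
       (\<beta> i j p * \<beta> r k q - \<beta> i r q * \<beta> j k p) * B $ p $ r) = 0)"
proof -
  define c where "c i j r = (\<Sum>k\<in>UNIV. \<beta> i j k * B $ k $ r)" for i j r
  define D where "D i j k q = (\<Sum>p\<in>UNIV. \<Sum>r\<in>UNIV.
       (\<beta> i j p * \<beta> r k q - \<beta> i r q * \<beta> j k p) * B $ p $ r)" for i j k q
  have D_eq: "D i j k q = (\<Sum>r\<in>UNIV. c i j r * \<beta> r k q) - (\<Sum>r\<in>UNIV. c j k r * \<beta> i r q)"
    for i j k q
    unfolding D_def c_def
    by (subst sum.swap)
       (simp add: sum_distrib_left sum_subtractf left_diff_distrib right_diff_distrib mult_ac)
  have contract: "(\<Sum>q\<in>UNIV. (\<Sum>r\<in>UNIV. f r * \<beta> (g r) (h r) q) * B $ q $ l) =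
      (\<Sum>r\<in>UNIV. f r * c (g r) (h r) l)" for f :: "'m \<Rightarrow> real" and g h l
    unfolding c_def sum_distrib_left sum_distrib_right
    by (subst sum.swap) (simp add: mult.assoc)
  have "(\<Sum>r\<in>UNIV. c i j r * c r k l) - (\<Sum>r\<in>UNIV. c j k r * c i r l) =
      (\<Sum>q\<in>UNIV. D i j k q * B $ q $ l)" for i j k l
    using contract[of "c i j" "\<lambda>r. r" "\<lambda>r. k" l] contract[of "c j k" "\<lambda>r. i" "\<lambda>r. r" l]
    by (simp add: D_eq left_diff_distrib sum_subtractf)
  from this[symmetric] have "alg_associative c \<longleftrightarrow> (\<forall>i j k l. (\<Sum>q\<in>UNIV. D i j k q * B $ q $ l) = 0)"
    by (auto simp: alg_associative_iff)
  also have "\<dots> \<longleftrightarrow> (\<forall>i j k q. D i j k q = 0)"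
    by (simp only: mult_invertible_eq_0_iff[OF assms])
  finally show ?thesis
    unfolding D_def c_def[abs_def] .
qed

text \<open>The mirror image of the previous lemma: the outer \<open>A\<close> now turns the index \<open>p\<close> into the
  first factor \<open>i\<close>, so the cancellation takes place on the left.\<close>

lemma alg_associative_mult_left_iff:
  fixes A :: "real ^ 'm ^ 'm"
  assumes "invertible A"
  shows "alg_associative (\<lambda>i j r. \<Sum>k\<in>UNIV. A $ i $ k * \<gamma> k j r) \<longleftrightarrow>
    (\<forall>p j k l. (\<Sum>r\<in>UNIV. \<Sum>q\<in>UNIV.
       A $ r $ q * \<gamma> p j r * \<gamma> q k l - A $ j $ q * \<gamma> p r l * \<gamma> q k r) = 0)"
proof -
  define c where "c i j r = (\<Sum>k\<in>UNIV. A $ i $ k * \<gamma> k j r)" for i j r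
  define D where "D p j k l = (\<Sum>r\<in>UNIV. \<Sum>q\<in>UNIV.
       A $ r $ q * \<gamma> p j r * \<gamma> q k l - A $ j $ q * \<gamma> p r l * \<gamma> q k r)" for p j k l
  have D_eq: "D p j k l = (\<Sum>r\<in>UNIV. \<gamma> p j r * c r k l) - (\<Sum>r\<in>UNIV. \<gamma> p r l * c j k r)"
    for p j k l
    unfolding D_def c_def
    by (simp add: sum_distrib_left sum_subtractf mult_ac)
  have contract: "(\<Sum>p\<in>UNIV. A $ i $ p * (\<Sum>r\<in>UNIV. \<gamma> p (g r) (h r) * f r)) =
      (\<Sum>r\<in>UNIV. c i (g r) (h r) * f r)" for f :: "'m \<Rightarrow> real" and g h i
    unfolding c_def sum_distrib_left sum_distrib_right
    by (subst sum.swap) (simp add: mult.assoc)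
  have "(\<Sum>r\<in>UNIV. c i j r * c r k l) - (\<Sum>r\<in>UNIV. c j k r * c i r l) =
      (\<Sum>p\<in>UNIV. A $ i $ p * D p j k l)" for i j k l
    using contract[of i "\<lambda>r. j" "\<lambda>r. r" "\<lambda>r. c r k l"]
      contract[of i "\<lambda>r. r" "\<lambda>r. l" "\<lambda>r. c j k r"]
    by (simp add: D_eq right_diff_distrib sum_subtractf mult.commute[of "c j k _"])
  from this[symmetric] have "alg_associative c \<longleftrightarrow> (\<forall>j k l i. (\<Sum>p\<in>UNIV. A $ i $ p * D p j k l) = 0)"
    by (auto simp: alg_associative_iff)
  also have "\<dots> \<longleftrightarrow> (\<forall>j k l p. D p j k l = 0)"
    by (simp only: invertible_mult_eq_0_iff[OF assms])
  also have "\<dots> \<longleftrightarrow> (\<forall>p j k l. D p j k l = 0)"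
    by blast
  finally show ?thesis
    unfolding D_def c_def[abs_def] .
qed

theorem theorem4:
  fixes A :: "real \<Rightarrow> real ^ 'm ^ 'm"
  assumes "\<And>t. t \<ge> 0 \<Longrightarrow> invertible (A t)"
  shows
    "(\<forall>\<beta> :: real \<Rightarrow> 'm \<Rightarrow> 'm \<Rightarrow> 'm \<Rightarrow> real.
        (\<forall>s\<ge>0. \<forall>i k. (\<Sum>j\<in>UNIV. \<beta> s i j k) = A s $ i $ k) \<longrightarrow>
        {(s, t) \<in> time_pairs.
           alg_associative (\<lambda>i j r. \<Sum>k\<in>UNIV. \<beta> s i j k * matrix_inv (A t) $ k $ r)} =
        {(s, t) \<in> time_pairs.
           \<forall>i j k q. (\<Sum>p\<in>UNIV. \<Sum>r\<in>UNIV.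
             (\<beta> s i j p * \<beta> s r k q - \<beta> s i r q * \<beta> s j k p) * matrix_inv (A t) $ p $ r) = 0})
     \<and>
     (\<forall>\<gamma> :: real \<Rightarrow> 'm \<Rightarrow> 'm \<Rightarrow> 'm \<Rightarrow> real.
        (\<forall>t\<ge>0. \<forall>i k. (\<Sum>j\<in>UNIV. \<gamma> t i j k) = matrix_inv (A t) $ i $ k) \<longrightarrow>
        {(s, t) \<in> time_pairs.
           alg_associative (\<lambda>i j r. \<Sum>k\<in>UNIV. A s $ i $ k * \<gamma> t k j r)} =
        {(s, t) \<in> time_pairs.
           \<forall>p j k l. (\<Sum>r\<in>UNIV. \<Sum>q\<in>UNIV.
             A s $ r $ q * \<gamma> t p j r * \<gamma> t q k l - A s $ j $ q * \<gamma> t p r l * \<gamma> t q k r) = 0})"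
proof (intro conjI allI impI)
  fix \<beta> :: "real \<Rightarrow> 'm \<Rightarrow> 'm \<Rightarrow> 'm \<Rightarrow> real"
  have "invertible (matrix_inv (A t))" if "(s, t) \<in> time_pairs" for s t
    using that assms by (auto simp: time_pairs_def intro: invertible_matrix_inv)
  from alg_associative_mult_right_iff[OF this]
  show "{(s, t) \<in> time_pairs.
           alg_associative (\<lambda>i j r. \<Sum>k\<in>UNIV. \<beta> s i j k * matrix_inv (A t) $ k $ r)} =
        {(s, t) \<in> time_pairs.
           \<forall>i j k q. (\<Sum>p\<in>UNIV. \<Sum>r\<in>UNIV.
             (\<beta> s i j p * \<beta> s r k q - \<beta> s i r q * \<beta> s j k p) * matrix_inv (A t) $ p $ r) = 0}"
    by blast
next
  fix \<gamma> :: "real \<Rightarrow> 'm \<Rightarrow> 'm \<Rightarrow> 'm \<Rightarrow> real"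
  have "invertible (A s)" if "(s, t) \<in> time_pairs" for s t
    using that assms by (auto simp: time_pairs_def)
  from alg_associative_mult_left_iff[OF this]
  show "{(s, t) \<in> time_pairs.
           alg_associative (\<lambda>i j r. \<Sum>k\<in>UNIV. A s $ i $ k * \<gamma> t k j r)} =
        {(s, t) \<in> time_pairs.
           \<forall>p j k l. (\<Sum>r\<in>UNIV. \<Sum>q\<in>UNIV.
             A s $ r $ q * \<gamma> t p j r * \<gamma> t q k l - A s $ j $ q * \<gamma> t p r l * \<gamma> t q k r) = 0}"
    by blast
qed

end
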